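(* There are universal constants $c,C_1,C_2>0$ such that the following holds. Let $f\colon\mathbb{R}^d\to\mathbb{R}$ be convex with a global minimizer $x^*$, $\|x^*\|\le\mathcal{R}$, $\mathcal{R}>0$, $f^*=f(x^* )$, and suppose that $f$ is $(\mathcal{M}_0,\mathcal{M}_1)$-Lipschitz with $\mathcal{M}_0,\mathcal{M}_1\ge0$. Let $\epsilon>0$, put $\epsilon'=c\,\epsilon$, and let $K\in\mathbb{N}$ and $\eta_k>0$ be given by $$\frac{1}{\eta_k}=\max\Big\{2\mathcal{M}_1^2\mathcal{F},\ \frac{\mathcal{M}_0\sqrt{K+1}}{\mathcal{R}}\Big\},\qquad K=\Big\lceil[\mathcal{R}\mathcal{M}_1]^2\cdot\frac{\mathcal{F}}{\epsilon'}+\Big[\frac{\mathcal{R}\mathcal{M}_0}{\epsilon'}\Big]^2\Big\rceil .$$ Let $x_0=0$, $x_{k+1}=\mathrm{proj}_{Q_{\mathcal{R}}}\big(x_k-\eta_k\nabla f(x_k)\big)$ with $\nabla f(x_k)\in\partial f(x_k)$ arbitrary, and $\overline{x}_K=\frac{1}{K+1}\sum_{k=0}^K x_k$. Then $f(\overline{x}_K)-f^*\le\epsilon$, and the number of iterations satisfies $$K\le\Big\lceil C_1\Big(\exp(C_2\mathcal{R}\mathcal{M}_1)\cdot\frac{\mathcal{R}\mathcal{M}_0}{\epsilon}+\Big[\frac{\mathcal{R}\mathcal{M}_0}{\epsilon}\Big]^2\Big)\Big\rceil .$$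
   Context: $\|\cdot\|$ is the Euclidean norm; $Q_{\mathcal{R}}=\{x\in\mathbb{R}^d:\|x\|\le\mathcal{R}\}$; $\mathrm{proj}_{Q_{\mathcal R}}$ is the Euclidean projection onto $Q_{\mathcal R}$; $\mathcal{F}=\max_{x\in Q_{\mathcal{R}}}[f(x)-f^*]$; $\mathbb{N}$ is the set of positive integers. $f$ is $(\mathcal{M}_0,\mathcal{M}_1)$-Lipschitz if $\limsup_{u\to0}\frac{1}{\|u\|}|f(x+u)-f(x)|\le\mathcal{M}_0+\mathcal{M}_1[f(x)-f^*]$ for all $x\in\mathbb{R}^d$ (for convex $f$, equivalently: $\|g\|\le\mathcal{M}_0+\mathcal{M}_1[f(x)-f^*]$ for all $x$ and all $g\in\partial f(x)$). *)

theory Defs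
  imports "HOL-Analysis.Analysis" "HOL-Library.Poly_Mapping"
begin

text \<open>
  The constants of the theorem must not depend on the dimension, so the dimension has to be
  quantified inside the formula and cannot be a type. All spaces \<open>R^d\<close> are therefore realised
  inside one type, the finitely supported real sequences \<open>nat \<Rightarrow>\<^sub>0 real\<close>, as the vectors supported
  on the coordinates \<open>0, ..., d - 1\<close>. The type carries the standard inner product and its norm.
\<close>

instantiation poly_mapping :: (type, real_vector) real_vector
begin

lift_definition scaleR_poly_mapping :: "real \<Rightarrow> ('a \<Rightarrow>\<^sub>0 'b) \<Rightarrow> 'a \<Rightarrow>\<^sub>0 'b"
  is "\<lambda>r p i. r *\<^sub>R p i"
  by (rule finite_subset[rotated], assumption) auto

instance
  by (standard; transfer) (auto simp: scaleR_add_right scaleR_add_left)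

end

lemma lookup_scaleR [simp]: "Poly_Mapping.lookup (r *\<^sub>R p) i = r *\<^sub>R Poly_Mapping.lookup p i"
  by transfer simp

instantiation poly_mapping :: (type, real_inner) real_inner
begin

definition inner_poly_mapping :: "('a \<Rightarrow>\<^sub>0 'b) \<Rightarrow> ('a \<Rightarrow>\<^sub>0 'b) \<Rightarrow> real"
  where "inner_poly_mapping p q =
    (\<Sum>i\<in>Poly_Mapping.keys p. Poly_Mapping.lookup p i \<bullet> Poly_Mapping.lookup q i)"

definition norm_poly_mapping :: "('a \<Rightarrow>\<^sub>0 'b) \<Rightarrow> real"
  where "norm_poly_mapping p = sqrt (p \<bullet> p)"

definition sgn_poly_mapping :: "('a \<Rightarrow>\<^sub>0 'b) \<Rightarrow> 'a \<Rightarrow>\<^sub>0 'b"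
  where "sgn_poly_mapping p = inverse (norm p) *\<^sub>R p"

definition dist_poly_mapping :: "('a \<Rightarrow>\<^sub>0 'b) \<Rightarrow> ('a \<Rightarrow>\<^sub>0 'b) \<Rightarrow> real"
  where "dist_poly_mapping p q = norm (p - q)"

definition uniformity_poly_mapping :: "(('a \<Rightarrow>\<^sub>0 'b) \<times> ('a \<Rightarrow>\<^sub>0 'b)) filter"
  where "uniformity_poly_mapping = (INF e\<in>{0<..}. principal {(p, q). dist p q < e})"

definition open_poly_mapping :: "('a \<Rightarrow>\<^sub>0 'b) set \<Rightarrow> bool"
  where "open_poly_mapping U \<longleftrightarrow> (\<forall>p\<in>U. \<forall>\<^sub>F (p', q) in uniformity. p' = p \<longrightarrow> q \<in> U)"

lemma inner_poly_mapping_superset: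
  fixes p q :: "'a \<Rightarrow>\<^sub>0 'b"
  assumes "finite A" "Poly_Mapping.keys p \<subseteq> A"
  shows "p \<bullet> q = (\<Sum>i\<in>A. Poly_Mapping.lookup p i \<bullet> Poly_Mapping.lookup q i)"
  unfolding inner_poly_mapping_def using assms
  by (intro sum.mono_neutral_left) (auto simp: in_keys_iff)

instance
proof
  fix p q s :: "'a \<Rightarrow>\<^sub>0 'b" and r :: real and U :: "('a \<Rightarrow>\<^sub>0 'b) set"
  show "dist p q = norm (p - q)" by (rule dist_poly_mapping_def)
  show "sgn p = inverse (norm p) *\<^sub>R p" by (rule sgn_poly_mapping_def)
  show "uniformity = (INF e\<in>{0<..}. principal {(p, q :: 'a \<Rightarrow>\<^sub>0 'b). dist p q < e})"
    by (rule uniformity_poly_mapping_def)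
  show "open U \<longleftrightarrow> (\<forall>p\<in>U. \<forall>\<^sub>F (p', q) in uniformity. p' = p \<longrightarrow> q \<in> U)"
    by (rule open_poly_mapping_def)
  show "norm p = sqrt (p \<bullet> p)" by (rule norm_poly_mapping_def)
  let ?A = "Poly_Mapping.keys p \<union> Poly_Mapping.keys q \<union> Poly_Mapping.keys (p + q)
    \<union> Poly_Mapping.keys (r *\<^sub>R p)"
  have in_A: "x \<bullet> y = (\<Sum>i\<in>?A. Poly_Mapping.lookup x i \<bullet> Poly_Mapping.lookup y i)"
    if "Poly_Mapping.keys x \<subseteq> ?A" for x y :: "'a \<Rightarrow>\<^sub>0 'b"
    using that by (intro inner_poly_mapping_superset) auto
  have keys: "Poly_Mapping.keys p \<subseteq> ?A" "Poly_Mapping.keys q \<subseteq> ?A"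
    "Poly_Mapping.keys (p + q) \<subseteq> ?A" "Poly_Mapping.keys (r *\<^sub>R p) \<subseteq> ?A"
    by auto
  show "p \<bullet> q = q \<bullet> p"
    unfolding in_A[OF keys(1), of q] in_A[OF keys(2), of p] by (simp add: inner_commute)
  show "(p + q) \<bullet> s = p \<bullet> s + q \<bullet> s"
    unfolding in_A[OF keys(1)] in_A[OF keys(2)] in_A[OF keys(3)]
    by (simp add: lookup_add inner_add_left sum.distrib)
  show "(r *\<^sub>R p) \<bullet> q = r * (p \<bullet> q)"
    unfolding in_A[OF keys(1)] in_A[OF keys(4)] by (simp add: sum_distrib_left)
  show "0 \<le> p \<bullet> p"
    unfolding inner_poly_mapping_def by (intro sum_nonneg) simp
  show "p \<bullet> p = 0 \<longleftrightarrow> p = 0"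
    unfolding inner_poly_mapping_def
    by (subst sum_nonneg_eq_0_iff)
      (auto simp: in_keys_iff poly_mapping_eq_iff fun_eq_iff)
qed

end

definition Rn :: "nat \<Rightarrow> (nat \<Rightarrow>\<^sub>0 real) set"
  where "Rn d = {x. \<forall>i\<ge>d. Poly_Mapping.lookup x i = 0}"

lemma subspace_Rn: "subspace (Rn d)"
  by (auto simp: subspace_def Rn_def lookup_add)

lemma inner_Rn:
  assumes "x \<in> Rn d"
  shows "x \<bullet> y = (\<Sum>i<d. Poly_Mapping.lookup x i * Poly_Mapping.lookup y i)"
  using inner_poly_mapping_superset[of "{..<d}" x y] assms
  by (force simp: Rn_def in_keys_iff not_le)

lemma norm_Rn:
  assumes "x \<in> Rn d"
  shows "norm x = sqrt (\<Sum>i<d. (Poly_Mapping.lookup x i)\<^sup>2)"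
  using inner_Rn[OF assms, of x] by (simp add: norm_eq_sqrt_inner power2_eq_square)

definition ball_Rn :: "nat \<Rightarrow> real \<Rightarrow> (nat \<Rightarrow>\<^sub>0 real) set"
  where "ball_Rn d R = {x \<in> Rn d. norm x \<le> R}"

text \<open>
  The same term as \<^const>\<open>closest_point\<close>, whose type is restricted to the class
  \<^class>\<open>heine_borel\<close>.
\<close>
definition proj :: "'a::real_inner set \<Rightarrow> 'a \<Rightarrow> 'a"
  where "proj S x = (SOME y. y \<in> S \<and> (\<forall>z\<in>S. dist x y \<le> dist x z))"

definition subdifferential ::
    "nat \<Rightarrow> ((nat \<Rightarrow>\<^sub>0 real) \<Rightarrow> real) \<Rightarrow> (nat \<Rightarrow>\<^sub>0 real) \<Rightarrow> (nat \<Rightarrow>\<^sub>0 real) set"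
  where "subdifferential d f x = {g \<in> Rn d. \<forall>y\<in>Rn d. f y \<ge> f x + g \<bullet> (y - x)}"

text \<open>The argument \<open>fstar\<close> is the minimal value of \<open>f\<close> on \<open>R^d\<close>.\<close>
definition gen_lipschitz ::
    "nat \<Rightarrow> real \<Rightarrow> real \<Rightarrow> ((nat \<Rightarrow>\<^sub>0 real) \<Rightarrow> real) \<Rightarrow> real \<Rightarrow> bool"
  where "gen_lipschitz d M0 M1 f fstar \<longleftrightarrow>
    (\<forall>x\<in>Rn d. Limsup (at 0 within Rn d) (\<lambda>u. ereal (1 / norm u * \<bar>f (x + u) - f x\<bar>))
      \<le> ereal (M0 + M1 * (f x - fstar)))"

text \<open>
  For convex \<open>f\<close> the supremum is over a continuous function on a compact set and is a maximum.
\<close>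
definition max_gap :: "nat \<Rightarrow> real \<Rightarrow> ((nat \<Rightarrow>\<^sub>0 real) \<Rightarrow> real) \<Rightarrow> real \<Rightarrow> real"
  where "max_gap d R f fstar = (SUP x\<in>ball_Rn d R. f x - fstar)"

end

theory Submission
  imports Defs
begin

text \<open>
  Write \<open>h x = f x - f*\<close>. Along the segment from the minimizer to a point of the ball,
  the growth condition is a differential inequality, whose integrated form is
  \<open>F \<le> 2 R M0 exp (2 R M1)\<close>; this turns the definition of \<open>K\<close> into the claimed bound.
  For the accuracy, \<open>\<parallel>g k\<parallel>\<^sup>2 \<le> 2 M0\<^sup>2 + 2 M1\<^sup>2 F h (x k)\<close>, and since \<open>2 M1\<^sup>2 F \<eta> \<le> 1\<close> half
  of the linear decrease in the standard estimate for \<open>\<parallel>x k - x*\<parallel>\<^sup>2\<close> survives: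
  \<open>\<eta> h (x k) \<le> \<parallel>x k - x*\<parallel>\<^sup>2 - \<parallel>x (k + 1) - x*\<parallel>\<^sup>2 + 2 \<eta>\<^sup>2 M0\<^sup>2\<close>. Summing and using convexity
  gives \<open>h xbar \<le> 5 \<epsilon>'\<close>.
\<close>

section \<open>A comparison principle for one-sided growth bounds\<close>

text \<open>A Gronwall argument for a function known only through forward increments. The set where
  \<open>\<phi>\<close> lies below a comparison function \<open>\<psi>\<close> is closed, so it has
  a last point; the growth bound pushes past any last point below 1. The slack \<open>e\<close> is
  sent to 0 at the end.\<close>

lemma right_growth_bound:
  fixes \<phi> :: "real \<Rightarrow> real"
  assumes cont: "continuous_on {0..1} \<phi>" and "\<phi> 0 \<le> 0" and "a \<ge> 0" "b \<ge> 0"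
    and step: "\<And>t e. 0 \<le> t \<Longrightarrow> t < 1 \<Longrightarrow> e > 0 \<Longrightarrow>
      \<exists>r>0. \<forall>h. 0 < h \<and> h < r \<longrightarrow> \<phi> (t + h) \<le> \<phi> t + h * (a + b * \<phi> t + e)"
  shows "\<phi> 1 \<le> a * exp b"
proof -
  have main: "\<phi> 1 \<le> (a + e) * exp b" if e: "e > 0" for e
  proof -
    \<comment> \<open>This \<open>\<psi>\<close> replaces the exact solution of
      \<open>y' = (a + e) + b * y\<close> with \<open>y 0 = 0\<close>. It dominates that solution,
      avoids division by \<open>b\<close>, and so covers \<open>b = 0\<close> as well.\<close>
    define \<psi> where "\<psi> t = (a + e) * t * exp (b * t)" for t :: real
    define S where "S = {t \<in> {0..1}. \<phi> t - \<psi> t \<in> {..0}}"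
    have "continuous_on {0..1} (\<lambda>t. \<phi> t - \<psi> t)"
      unfolding \<psi>_def by (intro continuous_intros cont)
    then have "closed S"
      unfolding S_def by (intro continuous_closed_preimage[unfolded vimage_def Int_def, simplified])
        (auto simp: conj_commute)
    moreover have "S \<subseteq> {0..1}" by (auto simp: S_def)
    ultimately have "compact S"
      by (metis compact_Icc compact_Int_closed inf.absorb2)
    moreover have "0 \<in> S" using assms(2) by (simp add: S_def \<psi>_def)
    ultimately obtain T where T: "T \<in> S" and Tmax: "\<And>t. t \<in> S \<Longrightarrow> t \<le> T"
      using compact_attains_sup[of S] by blast
    have T01: "0 \<le> T" "T \<le> 1" "\<phi> T \<le> \<psi> T" using T by (auto simp: S_def)
    have "T = 1"
    proof (rule ccontr)
      assume "T \<noteq> 1"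
      then have "T < 1" using T01 by simp
      from step[OF T01(1) this e] obtain r where r: "r > 0"
        "\<And>h. 0 < h \<Longrightarrow> h < r \<Longrightarrow> \<phi> (T + h) \<le> \<phi> T + h * (a + b * \<phi> T + e)" by blast
      define h where "h = min (r / 2) (1 - T)"
      have h: "0 < h" "h < r" "T + h \<le> 1" using r \<open>T < 1\<close> by (auto simp: h_def)
      have "\<phi> (T + h) \<le> \<phi> T + h * (a + b * \<phi> T + e)" using r(2) h by blast
      also have "\<dots> \<le> \<psi> T + h * (a + b * \<psi> T + e)"
        using T01 h \<open>b \<ge> 0\<close> by (intro add_mono mult_left_mono) auto
      also have "\<dots> = (a + e) * (T * exp (b * T) * (1 + b * h) + h * 1)"
        by (simp add: \<psi>_def algebra_simps)
      \<comment> \<open>Finite-increment form of \<open>\<psi>' \<ge> a + e + b * \<psi>\<close>: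
        use \<open>1 + b * h \<le> exp (b * h)\<close> in the first summand and
        \<open>1 \<le> exp (b * (T + h))\<close> in the second.\<close>
      also have "\<dots> \<le> (a + e) * (T * exp (b * T) * exp (b * h) + h * exp (b * (T + h)))"
        using T01 h \<open>a \<ge> 0\<close> \<open>b \<ge> 0\<close> e
        by (intro mult_left_mono add_mono exp_ge_add_one_self) auto
      also have "\<dots> = \<psi> (T + h)"
        by (simp add: \<psi>_def algebra_simps flip: exp_add)
      finally have "T + h \<in> S" using h T01 by (auto simp: S_def)
      from Tmax[OF this] h show False by simp
    qed
    then show ?thesis using T01 by (simp add: \<psi>_def)
  qed
  show ?thesis
  proof (rule field_le_epsilon)
    fix e :: real assume "e > 0"
    have "\<phi> 1 \<le> (a + e / exp b) * exp b" using \<open>e > 0\<close> by (intro main) simp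
    then show "\<phi> 1 \<le> a * exp b + e" by (simp add: algebra_simps)
  qed
qed

section \<open>Consequences of the generalized Lipschitz condition\<close>

text \<open>An upper bound on a limsup gives an eventual bound only for constants strictly above it,
  hence the strict inequality for \<open>L\<close>.\<close>

lemma gen_lipschitz_local:
  assumes "gen_lipschitz d M0 M1 f fstar" "x \<in> Rn d" "M0 + M1 * (f x - fstar) < L"
  obtains r where "r > 0"
    "\<And>u. u \<in> Rn d \<Longrightarrow> norm u < r \<Longrightarrow> \<bar>f (x + u) - f x\<bar> \<le> L * norm u"
proof -
  have "Limsup (at 0 within Rn d) (\<lambda>u. ereal (1 / norm u * \<bar>f (x + u) - f x\<bar>))
      \<le> ereal (M0 + M1 * (f x - fstar))"
    using assms(1,2) unfolding gen_lipschitz_def by blast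
  also have "\<dots> < ereal L" using assms(3) by simp
  finally have "\<forall>\<^sub>F u in at 0 within Rn d. ereal (1 / norm u * \<bar>f (x + u) - f x\<bar>) < ereal L"
    by (rule Limsup_lessD)
  then obtain r where r: "r > 0"
    "\<And>u. u \<in> Rn d \<Longrightarrow> u \<noteq> 0 \<Longrightarrow> norm u < r \<Longrightarrow> 1 / norm u * \<bar>f (x + u) - f x\<bar> < L"
    unfolding eventually_at by (auto simp: dist_norm)
  have "\<bar>f (x + u) - f x\<bar> \<le> L * norm u" if "u \<in> Rn d" "norm u < r" for u
  proof (cases "u = 0")
    case False
    then show ?thesis using r(2)[OF that(1) False that(2)] by (simp add: field_simps)
  qed simp
  with r(1) show thesis by (rule that)
qed

text \<open>Move a short way along \<open>g\<close> itself: the subgradient inequality forces an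
  increase of at least \<open>t * (norm g)\<^sup>2\<close>, while the local estimate allows at most
  \<open>L * t * norm g\<close> with \<open>L < norm g\<close>.\<close>

lemma subgradient_norm_le:
  assumes "gen_lipschitz d M0 M1 f fstar" "x \<in> Rn d" "g \<in> subdifferential d f x"
    and "M0 \<ge> 0" "M1 \<ge> 0" "fstar \<le> f x"
  shows "norm g \<le> M0 + M1 * (f x - fstar)"
proof (rule ccontr)
  assume "\<not> ?thesis"
  then obtain L where L: "M0 + M1 * (f x - fstar) < L" "L < norm g"
    using dense by (metis not_le)
  have "0 \<le> M0 + M1 * (f x - fstar)" using assms by simp
  with L have g: "norm g > 0" by linarith
  obtain r where r: "r > 0"
    "\<And>u. u \<in> Rn d \<Longrightarrow> norm u < r \<Longrightarrow> \<bar>f (x + u) - f x\<bar> \<le> L * norm u"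
    using gen_lipschitz_local[OF assms(1,2) L(1)] by blast
  define t where "t = r / (2 * norm g)"
  have t: "t > 0" "t * norm g < r" using r(1) g by (auto simp: t_def)
  have gR: "g \<in> Rn d" using assms(3) by (simp add: subdifferential_def)
  then have tR: "t *\<^sub>R g \<in> Rn d" by (rule subspace_scale[OF subspace_Rn])
  then have "x + t *\<^sub>R g \<in> Rn d" using assms(2) subspace_add[OF subspace_Rn] by blast
  then have "f (x + t *\<^sub>R g) \<ge> f x + g \<bullet> (x + t *\<^sub>R g - x)"
    using assms(3) unfolding subdifferential_def by blast
  then have "norm g * (t * norm g) \<le> f (x + t *\<^sub>R g) - f x"
    by (simp add: power2_norm_eq_inner[symmetric] power2_eq_square mult_ac)
  also have "\<dots> \<le> L * (t * norm g)" using r(2)[OF tR] t g by simp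
  finally show False using L(2) t g by simp
qed

text \<open>On the segment from \<open>z\<close> to \<open>x\<close>, of length \<open>s\<close>,
  the gap \<open>\<phi>\<close> starts at 0 and grows at rate at most
  \<open>s * M0 + s * M1 * \<phi>\<close>, so the comparison principle applies.\<close>

lemma gen_lipschitz_gap_le:
  assumes lip: "gen_lipschitz d M0 M1 f (f z)" and z: "z \<in> Rn d" and x: "x \<in> Rn d"
    and M: "M0 \<ge> 0" "M1 \<ge> 0"
  shows "f x - f z \<le> norm (x - z) * M0 * exp (norm (x - z) * M1)"
proof -
  define v where "v = x - z"
  define s where "s = norm v"
  define p where "p t = z + t *\<^sub>R v" for t
  define \<phi> where "\<phi> t = f (p t) - f z" for t
  have v: "v \<in> Rn d" using x z subspace_diff[OF subspace_Rn] by (simp add: v_def)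
  have hv: "h *\<^sub>R v \<in> Rn d" for h using v subspace_scale[OF subspace_Rn] by blast
  have p: "p t \<in> Rn d" for t
    unfolding p_def using z hv subspace_add[OF subspace_Rn] by blast
  \<comment> \<open>The estimate is two-sided in \<open>h\<close> because it serves twice: small
    \<open>h\<close> of either sign gives continuity of \<open>\<phi>\<close>, and
    \<open>h > 0\<close> gives the growth bound.\<close>
  have local: "\<exists>r>0. \<forall>h. \<bar>h\<bar> < r \<longrightarrow> \<bar>\<phi> (t + h) - \<phi> t\<bar> \<le> \<bar>h\<bar> * (s * M0 + s * M1 * \<phi> t + e)"
    if "e > 0" for t e
  proof -
    \<comment> \<open>Dividing by \<open>s + 1\<close> instead of \<open>s\<close> keeps the case
      \<open>x = z\<close> regular; multiplying by \<open>s\<close> still leaves an error of at most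
      \<open>e\<close>.\<close>
    define L where "L = M0 + M1 * (f (p t) - f z) + e / (s + 1)"
    have s: "s \<ge> 0" by (simp add: s_def)
    then have "M0 + M1 * (f (p t) - f z) < L" using that by (simp add: L_def)
    then obtain r where r: "r > 0"
      "\<And>u. u \<in> Rn d \<Longrightarrow> norm u < r \<Longrightarrow> \<bar>f (p t + u) - f (p t)\<bar> \<le> L * norm u"
      using gen_lipschitz_local[OF lip p] by blast
    have "s * L \<le> s * M0 + s * M1 * \<phi> t + e"
      using s that by (simp add: L_def \<phi>_def field_simps)
    moreover have "\<bar>\<phi> (t + h) - \<phi> t\<bar> \<le> \<bar>h\<bar> * (s * L)" if "\<bar>h\<bar> < r / (s + 1)" for h
    proof -
      have "\<bar>h\<bar> * s \<le> \<bar>h\<bar> * (s + 1)" by (simp add: mult_left_mono)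
      also have "\<dots> < r" using that s by (simp add: field_simps)
      finally have "norm (h *\<^sub>R v) < r" by (simp add: s_def)
      from r(2)[OF hv this] show ?thesis
        by (simp add: \<phi>_def p_def s_def algebra_simps)
    qed
    moreover have "r / (s + 1) > 0" using r(1) s by simp
    ultimately show ?thesis
      by (meson abs_ge_zero mult_left_mono order_trans)
  qed
  have "isCont \<phi> t" for t
  proof -
    define B where "B = s * M0 + s * M1 * \<phi> t + 1"
    obtain r where r: "r > 0" "\<And>h. \<bar>h\<bar> < r \<Longrightarrow> \<bar>\<phi> (t + h) - \<phi> t\<bar> \<le> \<bar>h\<bar> * B"
      using local[of 1 t] unfolding B_def by auto
    have "((\<lambda>h. \<phi> (t + h) - \<phi> t) \<longlongrightarrow> 0) (at 0)"
    proof (rule Lim_null_comparison)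
      show "\<forall>\<^sub>F h in at 0. norm (\<phi> (t + h) - \<phi> t) \<le> \<bar>h\<bar> * B"
        using r unfolding eventually_at by (auto intro!: exI[of _ r])
      show "((\<lambda>h. \<bar>h\<bar> * B) \<longlongrightarrow> 0) (at 0)"
        by (rule tendsto_eq_intros | simp)+
    qed
    then show ?thesis
      by (simp add: isCont_iff LIM_zero_iff)
  qed
  then have "continuous_on {0..1} \<phi>" by (simp add: continuous_at_imp_continuous_on)
  then have "\<phi> 1 \<le> s * M0 * exp (s * M1)"
  proof (rule right_growth_bound)
    show "\<exists>r>0. \<forall>h. 0 < h \<and> h < r \<longrightarrow> \<phi> (t + h) \<le> \<phi> t + h * (s * M0 + s * M1 * \<phi> t + e)"
      if "e > 0" for t e
    proof -
      obtain r where "r > 0"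
        and r: "\<And>h. \<bar>h\<bar> < r \<Longrightarrow> \<bar>\<phi> (t + h) - \<phi> t\<bar> \<le> \<bar>h\<bar> * (s * M0 + s * M1 * \<phi> t + e)"
        using local[OF \<open>e > 0\<close>, of t] by blast
      moreover have "\<phi> (t + h) \<le> \<phi> t + h * (s * M0 + s * M1 * \<phi> t + e)" if "0 < h" "h < r" for h
        using r[of h] that by simp
      ultimately show ?thesis by blast
    qed
  qed (use M in \<open>auto simp: \<phi>_def p_def s_def\<close>)
  then show ?thesis by (simp add: \<phi>_def p_def s_def v_def)
qed

section \<open>Projection onto the ball and one subgradient step\<close>

text \<open>Since \<open>proj\<close> is a choice operator, a nearest point must first be exhibited:
  \<open>y\<close> itself inside the ball, otherwise its radial rescaling to norm \<open>R\<close>,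
  which is optimal by the reverse triangle inequality.\<close>

lemma proj_ball_Rn:
  assumes "y \<in> Rn d" "R \<ge> 0"
  shows "proj (ball_Rn d R) y \<in> ball_Rn d R"
    and "\<And>z. z \<in> ball_Rn d R \<Longrightarrow> dist y (proj (ball_Rn d R) y) \<le> dist y z"
proof -
  have "\<exists>q. q \<in> ball_Rn d R \<and> (\<forall>z\<in>ball_Rn d R. dist y q \<le> dist y z)"
  proof (cases "norm y \<le> R")
    case True
    then show ?thesis using assms by (auto simp: ball_Rn_def intro!: exI[of _ y])
  next
    case False
    then have y: "norm y > R" "norm y > 0" using assms by auto
    let ?q = "(R / norm y) *\<^sub>R y"
    have "?q \<in> ball_Rn d R"
      using assms y subspace_scale[OF subspace_Rn] by (simp add: ball_Rn_def)
    moreover have "dist y ?q \<le> dist y z" if "z \<in> ball_Rn d R" for z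
    proof -
      have "dist y ?q = norm ((1 - R / norm y) *\<^sub>R y)"
        by (simp add: dist_norm scaleR_diff_left)
      also have "\<dots> = norm y - R" using y by (simp add: field_simps)
      also have "\<dots> \<le> norm y - norm z" using that by (simp add: ball_Rn_def)
      also have "\<dots> \<le> dist y z" by (simp add: dist_norm norm_triangle_ineq2)
      finally show ?thesis .
    qed
    ultimately show ?thesis by blast
  qed
  from someI_ex[OF this]
  show "proj (ball_Rn d R) y \<in> ball_Rn d R"
    and "\<And>z. z \<in> ball_Rn d R \<Longrightarrow> dist y (proj (ball_Rn d R) y) \<le> dist y z"
    unfolding proj_def by blast+
qed

lemma convex_ball_Rn: "convex (ball_Rn d R)"
proof -
  have "ball_Rn d R = Rn d \<inter> cball 0 R" by (auto simp: ball_Rn_def)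
  then show ?thesis by (simp add: convex_Int subspace_imp_convex subspace_Rn)
qed

text \<open>The angle at the nearest point \<open>p\<close> between \<open>y\<close> and
  \<open>z\<close> is at least a right angle, since otherwise a small move from \<open>p\<close>
  towards \<open>z\<close> would come closer to \<open>y\<close>. Expanding \<open>y - z\<close>
  around \<open>p\<close> then gives the claim.\<close>

lemma nearest_point_dist_le:
  fixes y p z :: "'a::real_inner"
  assumes S: "convex S" and p: "p \<in> S" and z: "z \<in> S"
    and min: "\<And>w. w \<in> S \<Longrightarrow> dist y p \<le> dist y w"
  shows "(norm (p - z))\<^sup>2 \<le> (norm (y - z))\<^sup>2"
proof -
  have obtuse: "(y - p) \<bullet> (z - p) \<le> 0"
  proof (rule ccontr)
    assume "\<not> ?thesis"
    then obtain u where u: "u > 0" "u \<le> 1" "dist (p + u *\<^sub>R (z - p)) y < dist p y"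
      using closer_point_lemma[of y p z] by auto
    have "p + u *\<^sub>R (z - p) = (1 - u) *\<^sub>R p + u *\<^sub>R z" by (simp add: algebra_simps)
    then have "p + u *\<^sub>R (z - p) \<in> S" using convexD_alt[OF S p z, of u] u by simp
    from min[OF this] u show False by (simp add: dist_commute)
  qed
  have "(norm (y - z))\<^sup>2 = (norm (y - p))\<^sup>2 + (norm (p - z))\<^sup>2 - 2 * ((y - p) \<bullet> (z - p))"
    unfolding power2_norm_eq_inner by (simp add: algebra_simps inner_commute)
  then show ?thesis using obtuse zero_le_power2[of "norm (y - p)"] by linarith
qed

text \<open>Projecting does not increase the distance to \<open>z\<close>, so it suffices to expand
  the square for the unprojected point; the subgradient inequality at \<open>z\<close> bounds the
  cross term.\<close>

lemma projected_subgradient_step: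
  assumes x: "x \<in> Rn d" and R: "R \<ge> 0" and z: "z \<in> ball_Rn d R"
    and g: "g \<in> subdifferential d f x" and "\<eta> \<ge> 0"
  shows "(norm (proj (ball_Rn d R) (x - \<eta> *\<^sub>R g) - z))\<^sup>2
    \<le> (norm (x - z))\<^sup>2 - 2 * \<eta> * (f x - f z) + \<eta>\<^sup>2 * (norm g)\<^sup>2"
proof -
  let ?y = "x - \<eta> *\<^sub>R g"
  have zR: "z \<in> Rn d" using z by (simp add: ball_Rn_def)
  have "g \<in> Rn d" using g by (simp add: subdifferential_def)
  then have "?y \<in> Rn d"
    using x subspace_diff[OF subspace_Rn] subspace_scale[OF subspace_Rn] by blast
  then have "(norm (proj (ball_Rn d R) ?y - z))\<^sup>2 \<le> (norm (?y - z))\<^sup>2"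
    using nearest_point_dist_le[OF convex_ball_Rn _ z] proj_ball_Rn R by blast
  also have "\<dots> = (norm (x - z))\<^sup>2 + 2 * \<eta> * (g \<bullet> (z - x)) + \<eta>\<^sup>2 * (norm g)\<^sup>2"
    unfolding power2_norm_eq_inner by (simp add: algebra_simps inner_commute power2_eq_square)
  also have "f z \<ge> f x + g \<bullet> (z - x)" using g zR by (simp add: subdifferential_def)
  then have "2 * \<eta> * (g \<bullet> (z - x)) \<le> 2 * \<eta> * (f z - f x)"
    using \<open>\<eta> \<ge> 0\<close> by (intro mult_left_mono) auto
  finally show ?thesis by (simp add: algebra_simps)
qed

section \<open>Accuracy of the average and number of iterations\<close>

text \<open>The convergence analysis reduced to real sequences: \<open>D\<close> stands for the
  squared distances to the minimizer, \<open>h\<close> for the gaps and \<open>\<delta>\<close> for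
  \<epsilon>'. The first entry of the maximum absorbs the \<open>M1\<close> part of the error, the
  second balances the \<open>M0\<close> part against \<open>R\<close>.\<close>

lemma average_gap_le_of_descent:
  fixes D h :: "nat \<Rightarrow> real"
  assumes step: "\<And>k. D (Suc k) \<le> D k - 2 * \<eta> * h k + \<eta>\<^sup>2 * (M0 + M1 * h k)\<^sup>2"
    and D: "\<And>k. 0 \<le> D k" "D 0 \<le> R\<^sup>2" and h: "\<And>k. 0 \<le> h k" "\<And>k. h k \<le> F"
    and R: "R > 0" and M: "M0 \<ge> 0" "M1 \<ge> 0" and "\<delta> > 0" and "\<eta> > 0"
    and \<eta>: "1 / \<eta> = max (2 * M1\<^sup>2 * F) (M0 * sqrt (real K + 1) / R)"
    and K: "(R * M1)\<^sup>2 * (F / \<delta>) + (R * M0 / \<delta>)\<^sup>2 \<le> real K"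
  shows "(\<Sum>k=0..K. h k) / (real K + 1) \<le> 5 * \<delta>"
proof -
  define n where "n = real K + 1"
  have n: "n > 0" by (simp add: n_def)
  have F: "F \<ge> 0" using h[of 0] by linarith
  have \<eta>F: "\<eta> * (2 * M1\<^sup>2 * F) \<le> 1" and \<eta>M0: "\<eta> * (M0 * sqrt n) \<le> R"
  proof -
    have "2 * M1\<^sup>2 * F \<le> 1 / \<eta>" "M0 * sqrt n / R \<le> 1 / \<eta>" using \<eta> by (auto simp: n_def)
    then show "\<eta> * (2 * M1\<^sup>2 * F) \<le> 1" "\<eta> * (M0 * sqrt n) \<le> R"
      using \<open>\<eta> > 0\<close> R by (auto simp: field_simps)
  qed
  have step': "\<eta> * h k \<le> D k - D (Suc k) + 2 * \<eta>\<^sup>2 * M0\<^sup>2" for k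
  proof -
    have "(M0 + M1 * h k)\<^sup>2 \<le> 2 * M0\<^sup>2 + 2 * (M1 * h k)\<^sup>2"
      using sum_squares_bound[of M0 "M1 * h k"] by (simp add: power2_sum)
    \<comment> \<open>One factor \<open>h k\<close> is replaced by \<open>F\<close>, so that the
      quadratic term becomes linear and can be absorbed by the decrease.\<close>
    also have "(M1 * h k)\<^sup>2 \<le> M1\<^sup>2 * F * h k"
      using mult_left_mono[OF mult_right_mono[OF h(2) h(1), of k k], of "M1\<^sup>2"]
      by (simp add: power_mult_distrib power2_eq_square mult_ac)
    finally have "\<eta>\<^sup>2 * (M0 + M1 * h k)\<^sup>2 \<le> \<eta>\<^sup>2 * (2 * M0\<^sup>2 + 2 * (M1\<^sup>2 * F * h k))"
      by (intro mult_left_mono) auto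
    also have "\<dots> = 2 * \<eta>\<^sup>2 * M0\<^sup>2 + (\<eta> * (2 * M1\<^sup>2 * F)) * (\<eta> * h k)"
      by (simp add: algebra_simps power2_eq_square)
    also have "\<dots> \<le> 2 * \<eta>\<^sup>2 * M0\<^sup>2 + 1 * (\<eta> * h k)"
      using \<eta>F h(1)[of k] \<open>\<eta> > 0\<close> by (intro add_left_mono mult_right_mono) auto
    finally show ?thesis using step[of k] by (simp add: algebra_simps)
  qed
  have "(\<Sum>k=0..K. \<eta> * h k) \<le> (\<Sum>k=0..K. D k - D (Suc k) + 2 * \<eta>\<^sup>2 * M0\<^sup>2)"
    by (intro sum_mono step')
  also have "\<dots> = D 0 - D (Suc K) + n * (2 * \<eta>\<^sup>2 * M0\<^sup>2)"
    by (simp add: sum.distrib n_def atLeast0AtMost sum_telescope)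
  also have "\<dots> \<le> R\<^sup>2 + n * (2 * \<eta>\<^sup>2 * M0\<^sup>2)" using D(1)[of "Suc K"] D(2) by simp
  finally have "\<eta> * (\<Sum>k=0..K. h k) \<le> R\<^sup>2 + n * (2 * \<eta>\<^sup>2 * M0\<^sup>2)"
    by (simp add: sum_distrib_left)
  then have "(\<Sum>k=0..K. h k) \<le> R\<^sup>2 * (1 / \<eta>) + 2 * n * \<eta> * M0\<^sup>2"
    using \<open>\<eta> > 0\<close> by (simp add: field_simps power2_eq_square)
  \<comment> \<open>The maximum of two nonnegative numbers is at most their sum.\<close>
  also have "R\<^sup>2 * (1 / \<eta>) \<le> R\<^sup>2 * (2 * M1\<^sup>2 * F + M0 * sqrt n / R)"
    using \<eta> R M F by (intro mult_left_mono) (auto simp: n_def)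
  also have "2 * n * \<eta> * M0\<^sup>2 = 2 * (\<eta> * (M0 * sqrt n)) * (M0 * sqrt n)"
    using n by (simp add: power2_eq_square)
  also have "\<dots> \<le> 2 * R * (M0 * sqrt n)"
    using \<eta>M0 M n by (intro mult_right_mono) auto
  also have "R\<^sup>2 * (2 * M1\<^sup>2 * F + M0 * sqrt n / R) + 2 * R * (M0 * sqrt n)
      = 2 * ((R * M1)\<^sup>2 * F) + 3 * (R * M0 * sqrt n)"
    using R by (simp add: algebra_simps power2_eq_square)
  finally have sum: "(\<Sum>k=0..K. h k) \<le> 2 * ((R * M1)\<^sup>2 * F) + 3 * (R * M0 * sqrt n)"
    by simp
  \<comment> \<open>Both summands in the lower bound for \<open>K\<close> are nonnegative, so each
    of them separately is at most \<open>n\<close>.\<close>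
  have nonneg: "(R * M1)\<^sup>2 * (F / \<delta>) \<ge> 0" "(R * M0 / \<delta>)\<^sup>2 \<ge> 0"
    using F \<open>\<delta> > 0\<close> by auto
  have "(R * M1)\<^sup>2 * (F / \<delta>) \<le> n" using K nonneg unfolding n_def by linarith
  then have A: "(R * M1)\<^sup>2 * F \<le> \<delta> * n" using \<open>\<delta> > 0\<close> by (simp add: field_simps)
  have "(R * M0 / \<delta>)\<^sup>2 \<le> n" using K nonneg unfolding n_def by linarith
  then have "R * M0 / \<delta> \<le> sqrt n" by (rule real_le_rsqrt)
  then have "R * M0 \<le> \<delta> * sqrt n" using \<open>\<delta> > 0\<close> by (simp add: field_simps)
  then have "R * M0 * sqrt n \<le> \<delta> * sqrt n * sqrt n"
    using n by (intro mult_right_mono) auto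
  also have "\<dots> = \<delta> * n" using n by (simp add: mult.assoc)
  finally have B: "R * M0 * sqrt n \<le> \<delta> * n" .
  \<comment> \<open>The 5 is 2 from the \<open>M1\<close> term plus 3 from the \<open>M0\<close>
    term, of which 1 comes from \<open>R\<^sup>2 / \<eta>\<close> and 2 from the accumulated step
    error.\<close>
  have "(\<Sum>k=0..K. h k) \<le> 5 * \<delta> * n" using sum A B by simp
  then show ?thesis using n by (simp add: n_def field_simps)
qed

lemma convex_on_average_le:
  fixes f :: "'a::real_vector \<Rightarrow> real"
  assumes "convex_on S f" "\<And>k. x k \<in> S"
  shows "f ((1 / (real K + 1)) *\<^sub>R (\<Sum>k=0..K. x k)) \<le> (\<Sum>k=0..K. f (x k)) / (real K + 1)"
proof -
  have "f (\<Sum>k=0..K. (1 / (real K + 1)) *\<^sub>R x k) \<le> (\<Sum>k=0..K. 1 / (real K + 1) * f (x k))"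
    using assms by (intro convex_on_sum) auto
  then show ?thesis by (simp add: scaleR_sum_right sum_divide_distrib)
qed

text \<open>This absorbs the polynomial factor \<open>(R * M1)\<^sup>2\<close> into the
  exponential.\<close>

lemma square_le_2_exp:
  fixes t :: real
  assumes "t \<ge> 0"
  shows "t\<^sup>2 \<le> 2 * exp t"
  using exp_lower_Taylor_quadratic[OF assms] assms by simp

text \<open>The exponent 3 is 2 from the bound on \<open>F\<close> plus 1 from absorbing
  \<open>(R * M1)\<^sup>2\<close>. The factor 25 is the square of 5 in the \<open>M0\<close> term;
  the other term yields only 4 * 5 = 20.\<close>

lemma iteration_count_le:
  fixes R M0 M1 F \<epsilon> :: real
  assumes F: "F \<le> 2 * R * M0 * exp (2 * R * M1)" and R: "R > 0"
    and M: "M0 \<ge> 0" "M1 \<ge> 0" and "\<epsilon> > 0"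
  shows "(R * M1)\<^sup>2 * (F / (1 / 5 * \<epsilon>)) + (R * M0 / (1 / 5 * \<epsilon>))\<^sup>2
    \<le> 25 * (exp (3 * R * M1) * (R * M0 / \<epsilon>) + (R * M0 / \<epsilon>)\<^sup>2)"
proof -
  have "(R * M1)\<^sup>2 * F \<le> 2 * exp (R * M1) * (2 * R * M0 * exp (2 * R * M1))"
    using R M by (intro order_trans[OF mult_left_mono[OF F] mult_right_mono] square_le_2_exp) auto
  also have "\<dots> = 4 * (exp (3 * R * M1) * (R * M0))"
    by (simp add: algebra_simps flip: exp_add)
  finally have "(R * M1)\<^sup>2 * F * (5 / \<epsilon>) \<le> 4 * (exp (3 * R * M1) * (R * M0)) * (5 / \<epsilon>)"
    using \<open>\<epsilon> > 0\<close> by (intro mult_right_mono) auto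
  also have "\<dots> \<le> 25 * (exp (3 * R * M1) * (R * M0 / \<epsilon>))"
    using R M \<open>\<epsilon> > 0\<close> by (simp add: field_simps)
  finally have "(R * M1)\<^sup>2 * (F / (1 / 5 * \<epsilon>)) \<le> 25 * (exp (3 * R * M1) * (R * M0 / \<epsilon>))"
    by (simp add: mult_ac)
  moreover have "(R * M0 / (1 / 5 * \<epsilon>))\<^sup>2 = 25 * (R * M0 / \<epsilon>)\<^sup>2"
    by (simp add: power_divide power_mult_distrib)
  ultimately show ?thesis by simp
qed

theorem corollary1:
  shows "\<exists>c C1 C2 :: real. c > 0 \<and> C1 > 0 \<and> C2 > 0 \<and>
    (\<forall>(d :: nat) (f :: (nat \<Rightarrow>\<^sub>0 real) \<Rightarrow> real) (xstar :: nat \<Rightarrow>\<^sub>0 real) (R :: real)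
      (M0 :: real) (M1 :: real) (\<epsilon> :: real) (K :: nat) (\<eta> :: nat \<Rightarrow> real)
      (x :: nat \<Rightarrow> (nat \<Rightarrow>\<^sub>0 real)) (g :: nat \<Rightarrow> (nat \<Rightarrow>\<^sub>0 real)).
      let fstar = f xstar;
          F = max_gap d R f fstar;
          \<epsilon>' = c * \<epsilon>;
          xbar = (1 / (real K + 1)) *\<^sub>R (\<Sum>k=0..K. x k)
      in
        convex_on (Rn d) f \<longrightarrow>
        xstar \<in> Rn d \<longrightarrow> (\<forall>y\<in>Rn d. f xstar \<le> f y) \<longrightarrow>
        norm xstar \<le> R \<longrightarrow> R > 0 \<longrightarrow>
        M0 \<ge> 0 \<longrightarrow> M1 \<ge> 0 \<longrightarrow> gen_lipschitz d M0 M1 f fstar \<longrightarrow>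
        \<epsilon> > 0 \<longrightarrow>
        K \<ge> 1 \<longrightarrow> int K = \<lceil>(R * M1)\<^sup>2 * (F / \<epsilon>') + (R * M0 / \<epsilon>')\<^sup>2\<rceil> \<longrightarrow>
        (\<forall>k. \<eta> k > 0 \<and> 1 / \<eta> k = max (2 * M1\<^sup>2 * F) (M0 * sqrt (real K + 1) / R)) \<longrightarrow>
        x 0 = 0 \<longrightarrow>
        (\<forall>k. g k \<in> subdifferential d f (x k)) \<longrightarrow>
        (\<forall>k. x (Suc k) = proj (ball_Rn d R) (x k - \<eta> k *\<^sub>R g k)) \<longrightarrow>
        f xbar - fstar \<le> \<epsilon> \<and>
        int K \<le> \<lceil>C1 * (exp (C2 * R * M1) * (R * M0 / \<epsilon>) + (R * M0 / \<epsilon>)\<^sup>2)\<rceil>)"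
proof -
  \<comment> \<open>The constants are already inserted: c = 1/5 cancels the 5 of
    \<open>average_gap_le_of_descent\<close>, and 25 and 3 come from
    \<open>iteration_count_le\<close>.\<close>
  have "f xbar - f xstar \<le> \<epsilon> \<and>
      int K \<le> \<lceil>25 * (exp (3 * R * M1) * (R * M0 / \<epsilon>) + (R * M0 / \<epsilon>)\<^sup>2)\<rceil>"
    if F_def: "F = max_gap d R f (f xstar)"
      and xbar: "xbar = (1 / (real K + 1)) *\<^sub>R (\<Sum>k=0..K. x k)"
      and conv: "convex_on (Rn d) f" and xs: "xstar \<in> Rn d"
      and min: "\<forall>y\<in>Rn d. f xstar \<le> f y" and xsR: "norm xstar \<le> R" and R: "R > 0"
      and M: "M0 \<ge> 0" "M1 \<ge> 0" and lip: "gen_lipschitz d M0 M1 f (f xstar)" and \<epsilon>: "\<epsilon> > 0"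
      and K: "int K = \<lceil>(R * M1)\<^sup>2 * (F / (1 / 5 * \<epsilon>)) + (R * M0 / (1 / 5 * \<epsilon>))\<^sup>2\<rceil>"
      and \<eta>: "\<forall>k. \<eta> k > 0 \<and> 1 / \<eta> k = max (2 * M1\<^sup>2 * F) (M0 * sqrt (real K + 1) / R)"
      and x0: "x 0 = 0" and g: "\<forall>k. g k \<in> subdifferential d f (x k)"
      and xS: "\<forall>k. x (Suc k) = proj (ball_Rn d R) (x k - \<eta> k *\<^sub>R g k)"
    for d :: nat and f :: "(nat \<Rightarrow>\<^sub>0 real) \<Rightarrow> real" and xstar xbar :: "nat \<Rightarrow>\<^sub>0 real"
      and R M0 M1 \<epsilon> F :: real and K :: nat and \<eta> :: "nat \<Rightarrow> real"
      and x g :: "nat \<Rightarrow> (nat \<Rightarrow>\<^sub>0 real)"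
  proof -
    let ?B = "2 * R * M0 * exp (2 * R * M1)"
    \<comment> \<open>Both \<open>y\<close> and \<open>xstar\<close> have norm at most
      \<open>R\<close>, hence the length \<open>2 * R\<close> in \<open>?B\<close>.\<close>
    have gap: "f y - f xstar \<le> ?B" if "y \<in> ball_Rn d R" for y
    proof -
      have y: "y \<in> Rn d" "norm y \<le> R" using that by (auto simp: ball_Rn_def)
      have s: "norm (y - xstar) \<le> 2 * R" using norm_triangle_ineq4[of y xstar] y xsR by simp
      have "f y - f xstar \<le> norm (y - xstar) * M0 * exp (norm (y - xstar) * M1)"
        by (rule gen_lipschitz_gap_le[OF lip xs y(1) M])
      also have "\<dots> \<le> ?B" using s M R by (intro mult_mono) (auto simp: mult_right_mono)
      finally show ?thesis .
    qed
    have zero: "0 \<in> ball_Rn d R" using R by (simp add: ball_Rn_def Rn_def)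
    have FB: "F \<le> ?B"
      unfolding F_def max_gap_def using zero gap by (intro cSUP_least) auto
    \<comment> \<open>A real supremum dominates its members only for a family bounded above;
      \<open>gap\<close> supplies that bound.\<close>
    have leF: "f y - f xstar \<le> F" if "y \<in> ball_Rn d R" for y
      unfolding F_def max_gap_def using gap that by (intro cSUP_upper) (auto intro!: bdd_aboveI2)
    have xball: "x k \<in> ball_Rn d R" for k
    proof (induction k)
      case 0
      show ?case using zero x0 by simp
    next
      case (Suc k)
      have "x k - \<eta> k *\<^sub>R g k \<in> Rn d"
        using Suc g subspace_diff[OF subspace_Rn] subspace_scale[OF subspace_Rn]
        by (simp add: ball_Rn_def subdifferential_def)
      then show ?case using xS proj_ball_Rn(1) R by simp
    qed
    then have xR: "x k \<in> Rn d" for k by (simp add: ball_Rn_def)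
    \<comment> \<open>The prescribed value of \<open>1 / \<eta> k\<close> does not depend on
      \<open>k\<close>, so \<open>\<eta> 0\<close> serves as the single step size of the descent
      lemma.\<close>
    have \<eta>eq: "\<eta> k = \<eta> 0" for k using \<eta> by (metis inverse_eq_divide inverse_inverse_eq)
    have Kreal: "(R * M1)\<^sup>2 * (F / (1 / 5 * \<epsilon>)) + (R * M0 / (1 / 5 * \<epsilon>))\<^sup>2 \<le> real K"
      using K by (metis le_of_int_ceiling of_int_of_nat_eq)
    have "(\<Sum>k=0..K. f (x k) - f xstar) / (real K + 1) \<le> 5 * (1 / 5 * \<epsilon>)"
    proof (rule average_gap_le_of_descent[where D = "\<lambda>k. (norm (x k - xstar))\<^sup>2"])
      fix k
      have "norm (g k) \<le> M0 + M1 * (f (x k) - f xstar)"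
        using subgradient_norm_le[OF lip xR _ M] g min xR by blast
      then have "(\<eta> 0)\<^sup>2 * (norm (g k))\<^sup>2 \<le> (\<eta> 0)\<^sup>2 * (M0 + M1 * (f (x k) - f xstar))\<^sup>2"
        by (intro mult_left_mono power_mono) auto
      moreover have "(norm (x (Suc k) - xstar))\<^sup>2
        \<le> (norm (x k - xstar))\<^sup>2 - 2 * \<eta> 0 * (f (x k) - f xstar) + (\<eta> 0)\<^sup>2 * (norm (g k))\<^sup>2"
        using projected_subgradient_step[of "x k" d R xstar "g k" f "\<eta> 0"] xR R g \<eta> xs xsR
        by (simp add: ball_Rn_def xS[rule_format] \<eta>eq[of k] less_imp_le)
      ultimately show "(norm (x (Suc k) - xstar))\<^sup>2 \<le> (norm (x k - xstar))\<^sup>2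
        - 2 * \<eta> 0 * (f (x k) - f xstar) + (\<eta> 0)\<^sup>2 * (M0 + M1 * (f (x k) - f xstar))\<^sup>2"
        by linarith
    next
      show "(norm (x 0 - xstar))\<^sup>2 \<le> R\<^sup>2" using x0 xsR by (simp add: power_mono)
    next
      show "1 / \<eta> 0 = max (2 * M1\<^sup>2 * F) (M0 * sqrt (real K + 1) / R)" using \<eta> by blast
    qed (use min xR leF[OF xball] R M \<epsilon> \<eta> Kreal in auto)
    moreover have "(\<Sum>k=0..K. f (x k) - f xstar) / (real K + 1)
      = (\<Sum>k=0..K. f (x k)) / (real K + 1) - f xstar"
      by (simp add: sum_subtractf field_simps)
    ultimately have "f xbar - f xstar \<le> \<epsilon>"
      using convex_on_average_le[where x = x, OF conv xR, of K] unfolding xbar by simp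
    moreover have "int K \<le> \<lceil>25 * (exp (3 * R * M1) * (R * M0 / \<epsilon>) + (R * M0 / \<epsilon>)\<^sup>2)\<rceil>"
      unfolding K using iteration_count_le[OF FB R M \<epsilon>] by (rule ceiling_mono)
    ultimately show ?thesis by blast
  qed
  note main = this
  show ?thesis
  proof (rule exI[of _ "1 / 5"], rule exI[of _ 25], rule exI[of _ 3], intro conjI allI,
      goal_cases)
    \<comment> \<open>The first three goals are the positivity of the constants. Here unfolding
      \<open>Let\<close> turns the two equations for \<open>F\<close> and \<open>xbar\<close> into
      reflexivity.\<close>
    case 4
    show ?case
      unfolding Let_def by (intro impI, rule main; (assumption | rule refl))
  qed simp_all
qed

end
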